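(* Let $\lambda\in\mathbb{R}$. The unitary operator $U=e^{\lambda(a^2-a^{+2})}$ can be presented in the form $$U=e^{\lambda(a^2-a^{+2})}=e^{-\gamma a^{+2}}\,e^{\beta\left(a^{+}a+\frac12\right)}\,e^{\gamma a^{2}},$$ where $$2\gamma=\tanh(2\lambda),\qquad e^{\beta}=\frac{1}{\cosh(2\lambda)}.$$
   Context: Let $\{e_n\}_{n=0}^\infty$ be an orthonormal basis of a Hilbert space. $a$ and $a^+$ are the annihilation and creation operators of the harmonic oscillator: $a\,e_n=\sqrt{n}\,e_{n-1}$ (with $a\,e_0=0$), $a^+e_n=\sqrt{n+1}\,e_{n+1}$, so that $[a,a^+]=1$ and $a^+a\,e_n=n\,e_n$; $a^{+2}=(a^+)^2$. $U$ is the unitary operator generated by the (closure of the) skew-symmetric operator $\lambda(a^2-a^{+2})$ on finite linear combinations of the $e_n$. The product on the right-hand side is understood as acting on the basis vectors $e_n$ (hence on their finite linear combinations): $e^{\gamma a^2}$ and $e^{-\gamma a^{+2}}$ act through their power series and $e^{\beta(a^+a+1/2)}e_n=e^{\beta(n+1/2)}e_n$. *)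

theory Defs
  imports "HOL-Analysis.Analysis"
begin

text \<open>
  Complex Hilbert spaces. The underlying real Banach space is the library's; the complex
  inner product is antilinear in its first and linear in its second argument, and it
  induces the given norm (whence positive definiteness).
\<close>

class complex_hilbert = banach +
  fixes scaleC :: "complex \<Rightarrow> 'a \<Rightarrow> 'a" (infixr "*\<^sub>C" 75)
    and cinner :: "'a \<Rightarrow> 'a \<Rightarrow> complex"
  assumes scaleR_scaleC: "r *\<^sub>R x = complex_of_real r *\<^sub>C x"
    and scaleC_add_right: "c *\<^sub>C (x + y) = c *\<^sub>C x + c *\<^sub>C y"
    and scaleC_add_left: "(c + d) *\<^sub>C x = c *\<^sub>C x + d *\<^sub>C x"
    and scaleC_scaleC: "c *\<^sub>C d *\<^sub>C x = (c * d) *\<^sub>C x"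
    and scaleC_one: "1 *\<^sub>C x = x"
    and cinner_commute: "cinner x y = cnj (cinner y x)"
    and cinner_add_right: "cinner x (y + z) = cinner x y + cinner x z"
    and cinner_scaleC_right: "cinner x (c *\<^sub>C y) = c * cinner x y"
    and cinner_self: "cinner x x = complex_of_real ((norm x)\<^sup>2)"

interpretation cvec: vector_space "scaleC :: complex \<Rightarrow> 'a \<Rightarrow> 'a :: complex_hilbert"
  by unfold_locales
    (simp_all add: scaleC_add_right scaleC_add_left scaleC_scaleC scaleC_one)

definition orthonormal_basis :: "(nat \<Rightarrow> 'a :: complex_hilbert) \<Rightarrow> bool" where
  "orthonormal_basis e \<longleftrightarrow>
     (\<forall>m n. cinner (e m) (e n) = (if m = n then 1 else 0)) \<and>
     closure (cvec.span (range e)) = UNIV"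

text \<open>
  The ladder operators and functions of the number operator are meant on the dense domain
  \<open>cvec.span (range e)\<close>, where the series below have only finitely many nonzero terms, so
  that they are the linear maps determined by their values on the basis vectors. In the
  annihilation operator the term for \<open>n = 0\<close> vanishes, since \<open>sqrt 0 = 0\<close>.
\<close>

definition annihilation :: "(nat \<Rightarrow> 'a :: complex_hilbert) \<Rightarrow> 'a \<Rightarrow> 'a" where
  "annihilation e x = (\<Sum>n. (complex_of_real (sqrt n) * cinner (e n) x) *\<^sub>C e (n - 1))"

definition creation :: "(nat \<Rightarrow> 'a :: complex_hilbert) \<Rightarrow> 'a \<Rightarrow> 'a" where
  "creation e x = (\<Sum>n. (complex_of_real (sqrt (n + 1)) * cinner (e n) x) *\<^sub>C e (n + 1))"

text \<open>\<open>exp_number e \<beta>\<close> is the exponential of \<open>\<beta>\<close> times (number operator + 1/2).\<close>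

definition exp_number :: "(nat \<Rightarrow> 'a :: complex_hilbert) \<Rightarrow> real \<Rightarrow> 'a \<Rightarrow> 'a" where
  "exp_number e \<beta> x = (\<Sum>n. (complex_of_real (exp (\<beta> * (n + 1/2))) * cinner (e n) x) *\<^sub>C e n)"

lemma basis_suminf:
  assumes "orthonormal_basis e"
  shows "(\<Sum>n. (c n * cinner (e n) (e m)) *\<^sub>C f n) = c m *\<^sub>C f m"
  using assms by (subst suminf_finite[of "{m}"]) (auto simp: orthonormal_basis_def)

lemma
  assumes "orthonormal_basis e"
  shows annihilation_basis_0: "annihilation e (e 0) = 0"
    and annihilation_basis_Suc: "annihilation e (e (Suc n)) = sqrt (n + 1) *\<^sub>R e n"
    and creation_basis: "creation e (e n) = sqrt (n + 1) *\<^sub>R e (n + 1)"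
    and exp_number_basis: "exp_number e \<beta> (e n) = exp (\<beta> * (n + 1/2)) *\<^sub>R e n"
  unfolding annihilation_def creation_def exp_number_def
  by (simp_all only: basis_suminf[OF assms]) (simp_all add: scaleR_scaleC add.commute)

text \<open>The exponential of an operator acting through its power series.\<close>

definition exp_term :: "('a :: real_normed_vector \<Rightarrow> 'a) \<Rightarrow> 'a \<Rightarrow> nat \<Rightarrow> 'a" where
  "exp_term T x k = (T ^^ k) x /\<^sub>R fact k"

definition exp_series :: "('a :: real_normed_vector \<Rightarrow> 'a) \<Rightarrow> 'a \<Rightarrow> 'a" where
  "exp_series T x = (\<Sum>k. exp_term T x k)"

definition unitary :: "('a :: complex_hilbert \<Rightarrow> 'a) \<Rightarrow> bool" where
  "unitary U \<longleftrightarrow> Vector_Spaces.linear scaleC scaleC U \<and> surj U \<and>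
     (\<forall>x y. cinner (U x) (U y) = cinner x y)"

definition unitary_group :: "(real \<Rightarrow> 'a :: complex_hilbert \<Rightarrow> 'a) \<Rightarrow> bool" where
  "unitary_group V \<longleftrightarrow> (\<forall>t. unitary (V t)) \<and> V 0 = id \<and>
     (\<forall>s t. V (s + t) = V s \<circ> V t) \<and> (\<forall>x. continuous_on UNIV (\<lambda>t. V t x))"

text \<open>
  Unbounded operators are represented by their graphs, so that the closure of an operator
  is the topological closure of its graph.
\<close>

definition generator :: "(real \<Rightarrow> 'a :: complex_hilbert \<Rightarrow> 'a) \<Rightarrow> ('a \<times> 'a) set" where
  "generator V = {(x, y). ((\<lambda>t. (V t x - x) /\<^sub>R t) \<longlongrightarrow> y) (at 0)}"

definition operator_graph :: "'a set \<Rightarrow> ('a \<Rightarrow> 'a) \<Rightarrow> ('a \<times> 'a) set" where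
  "operator_graph D T = (\<lambda>x. (x, T x)) ` D"

text \<open>
  \<open>U\<close> is the unitary operator \<open>exp A\<close> generated by the operator with graph \<open>A\<close>: the value
  at time 1 of the strongly continuous one-parameter unitary group with generator \<open>A\<close>.
\<close>

definition is_unitary_exp :: "('a \<times> 'a) set \<Rightarrow> ('a :: complex_hilbert \<Rightarrow> 'a) \<Rightarrow> bool" where
  "is_unitary_exp A U \<longleftrightarrow> (\<exists>V. unitary_group V \<and> generator V = A \<and> U = V 1)"

end

theory Submission
  imports Defs
begin

text \<open>
  Put the parameter \<open>l * t\<close> into the product of exponentials and apply it to
  \<open>f m = sqrt (fact m) *\<^sub>R e m\<close>. The factor with the annihilation operators yields a finite sum and
  the one with the creation operators the vectors
  \<open>G n x = (\<Sum>k. ((- x) ^ k / fact k) *\<^sub>R f (n + 2 * k))\<close>, which converge for \<open>\<bar>x\<bar> < 1/2\<close>, satisfy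
  \<open>G n' = - G (n + 2)\<close>, and lie in the domain of the closure of \<open>a\<^sup>2 - a'\<^sup>2\<close>, which maps
  \<open>G n x\<close> to
  \<open>(n * (n - 1)) *\<^sub>R G (n - 2) x - (4 * x * (n + 1/2)) *\<^sub>R G n x - (1 - 4 * x\<^sup>2) *\<^sub>R G (n + 2) x\<close>.
  The choice of \<open>\<gamma>\<close> and \<open>\<beta>\<close> means that \<open>\<gamma>' = l * (1 - 4 * \<gamma>\<^sup>2)\<close>, \<open>\<beta>' = - 4 * l * \<gamma>\<close> and
  \<open>exp (2 * \<beta>) = 1 - 4 * \<gamma>\<^sup>2\<close> along the path, so the product solves the same evolution equation as
  the unitary group. As the generator is skew, the norm of the difference of the two solutions is
  constant, hence zero.
\<close>

section \<open>The complex inner product and its norm\<close>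

text \<open>The norm axioms give homogeneity for real scalars only; for complex ones it is read off
  from \<open>cinner_self\<close>.\<close>

lemma norm_scaleC: "norm (c *\<^sub>C x) = cmod c * norm x"
proof -
  have "complex_of_real ((norm (c *\<^sub>C x))\<^sup>2) = complex_of_real ((cmod c * norm x)\<^sup>2)"
  proof -
    have "complex_of_real ((norm (c *\<^sub>C x))\<^sup>2) = c * cnj (c * cinner x x)"
      by (metis cinner_commute cinner_scaleC_right cinner_self)
    also have "\<dots> = complex_of_real ((cmod c * norm x)\<^sup>2)"
      by (simp add: cinner_self power_mult_distrib complex_norm_square del: of_real_power)
    finally show ?thesis .
  qed
  then have "(norm (c *\<^sub>C x))\<^sup>2 = (cmod c * norm x)\<^sup>2"
    by (simp only: of_real_eq_iff)
  then show ?thesis by simp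
qed

lemma scaleC_scaleR_commute: "c *\<^sub>C (r *\<^sub>R x) = r *\<^sub>R (c *\<^sub>C x)"
  by (simp add: scaleR_scaleC scaleC_scaleC mult.commute)

lemma bounded_linear_scaleC: "bounded_linear (\<lambda>x. c *\<^sub>C x)"
  by (rule bounded_linear_intro[where K = "cmod c"])
    (simp_all add: scaleC_add_right scaleC_scaleR_commute norm_scaleC mult.commute)

lemma cinner_add_left: "cinner (x + y) z = cinner x z + cinner y z"
  by (metis cinner_add_right cinner_commute complex_cnj_add)

lemma cinner_scaleC_left: "cinner (c *\<^sub>C x) y = cnj c * cinner x y"
  by (metis cinner_commute cinner_scaleC_right complex_cnj_mult)

lemma cinner_zero_right [simp]: "cinner x 0 = 0"
  using cinner_scaleC_right[of x 0 0] by simp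

lemma cinner_zero_left [simp]: "cinner 0 x = 0"
  using cinner_scaleC_left[of 0 0 x] by simp

lemma cinner_scaleR_right: "cinner x (r *\<^sub>R y) = r *\<^sub>R cinner x y"
  by (simp add: scaleR_scaleC cinner_scaleC_right scaleR_conv_of_real)

lemma cinner_scaleR_left: "cinner (r *\<^sub>R x) y = r *\<^sub>R cinner x y"
  by (simp add: scaleR_scaleC cinner_scaleC_left scaleR_conv_of_real)

lemma cinner_diff_right: "cinner x (y - z) = cinner x y - cinner x z"
  using cinner_add_right[of x "y - z" z] by simp

lemma Re_cinner_commute: "Re (cinner x y) = Re (cinner y x)"
  by (subst cinner_commute) simp

lemma Re_cinner_le: "\<bar>Re (cinner x y)\<bar> \<le> norm x * norm y"
proof (cases "y = 0")
  case False
  define r where "r = Re (cinner x y)"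
  define u where "u = (norm y)\<^sup>2"
  have u: "u > 0" using False by (simp add: u_def)
  \<comment> \<open>The vector is \<open>u\<close> times the component of \<open>x\<close>
    orthogonal to \<open>y\<close> in the real inner product; its squared norm gives
    Cauchy-Schwarz.\<close>
  have "0 \<le> Re (cinner (u *\<^sub>R x + (- r) *\<^sub>R y) (u *\<^sub>R x + (- r) *\<^sub>R y))"
    by (simp add: cinner_self)
  also have "\<dots> = u * (u * (norm x)\<^sup>2 - r\<^sup>2)"
    by (simp only: cinner_add_left cinner_add_right cinner_scaleR_left cinner_scaleR_right
        plus_complex.sel scaleR_complex.sel Re_cinner_commute[of y x] r_def[symmetric])
      (simp add: cinner_self u_def algebra_simps power2_eq_square)
  finally have "r\<^sup>2 \<le> (norm x * norm y)\<^sup>2"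
    using u by (simp add: zero_le_mult_iff u_def power_mult_distrib mult.commute)
  then have "\<bar>r\<bar> \<le> \<bar>norm x * norm y\<bar>"
    by (simp only: abs_le_square_iff)
  then show ?thesis
    by (simp add: r_def)
qed simp

text \<open>The product rule for this real form differentiates the squared norm of a curve.\<close>

lemma bounded_bilinear_Re_cinner: "bounded_bilinear (\<lambda>x y. Re (cinner x y))"
  by unfold_locales
    (auto simp: cinner_add_left cinner_add_right cinner_scaleR_left cinner_scaleR_right
      intro!: exI[of _ 1] Re_cinner_le)

section \<open>Maps that are linear on the span of the basis\<close>

text \<open>Linearity is asked for on the span only: elsewhere the series that define the ladder
  operators may diverge, and \<open>suminf\<close> then has no useful value.\<close>

definition linear_on_span :: "(nat \<Rightarrow> 'a :: complex_hilbert) \<Rightarrow> ('a \<Rightarrow> 'a) \<Rightarrow> bool" where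
  "linear_on_span e T \<longleftrightarrow> (\<forall>x\<in>cvec.span (range e). \<forall>y\<in>cvec.span (range e). \<forall>c.
     T (c *\<^sub>C x + y) = c *\<^sub>C T x + T y)"

lemma linear_on_spanD:
  "linear_on_span e T \<Longrightarrow> x \<in> cvec.span (range e) \<Longrightarrow> y \<in> cvec.span (range e) \<Longrightarrow>
    T (c *\<^sub>C x + y) = c *\<^sub>C T x + T y"
  by (simp add: linear_on_span_def)

lemma linear_on_span_zero:
  assumes "linear_on_span e T" shows "T 0 = 0"
  using linear_on_spanD[OF assms cvec.span_zero cvec.span_zero, of 1] by simp

lemma linear_on_span_scaleR:
  assumes "linear_on_span e T" "x \<in> cvec.span (range e)" shows "T (r *\<^sub>R x) = r *\<^sub>R T x"
  using linear_on_spanD[OF assms cvec.span_zero, of "complex_of_real r"] linear_on_span_zero[OF assms(1)]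
  by (simp add: scaleR_scaleC)

lemma linear_on_span_add:
  assumes "linear_on_span e T" "x \<in> cvec.span (range e)" "y \<in> cvec.span (range e)"
  shows "T (x + y) = T x + T y"
  using linear_on_spanD[OF assms, of 1] by simp

lemma span_scaleR: "x \<in> cvec.span B \<Longrightarrow> r *\<^sub>R x \<in> cvec.span B"
  by (simp add: scaleR_scaleC cvec.span_scale)

lemma linear_on_span_in_span:
  assumes "linear_on_span e T" "\<And>n. T (e n) \<in> cvec.span (range e)" "x \<in> cvec.span (range e)"
  shows "T x \<in> cvec.span (range e)"
proof -
  \<comment> \<open>Membership is carried through the induction because the linearity of
    \<open>T\<close> may be applied only inside the span.\<close>
  have "x \<in> cvec.span (range e) \<and> T x \<in> cvec.span (range e)"
    using assms(3)
  proof (induction rule: cvec.span_induct_alt)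
    case base
    then show ?case by (simp add: linear_on_span_zero[OF assms(1)] cvec.span_zero)
  next
    case (step c x y)
    then have "x \<in> cvec.span (range e)" "T x \<in> cvec.span (range e)"
      using assms(2) by (auto intro: cvec.span_base)
    with step show ?case
      by (simp add: linear_on_spanD[OF assms(1)] cvec.span_add cvec.span_scale)
  qed
  then show ?thesis ..
qed

lemma linear_on_span_eq:
  assumes "linear_on_span e S" "linear_on_span e T" "\<And>n. S (e n) = T (e n)"
    "x \<in> cvec.span (range e)"
  shows "S x = T x"
proof -
  have "x \<in> cvec.span (range e) \<and> S x = T x"
    using assms(4)
  proof (induction rule: cvec.span_induct_alt)
    case base
    then show ?case
      by (simp add: linear_on_span_zero[OF assms(1)] linear_on_span_zero[OF assms(2)] cvec.span_zero)
  next
    case (step c x y)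
    then have "x \<in> cvec.span (range e)" "S x = T x"
      using assms(3) by (auto intro: cvec.span_base)
    with step show ?case
      by (simp add: linear_on_spanD[OF assms(1)] linear_on_spanD[OF assms(2)] cvec.span_add cvec.span_scale)
  qed
  then show ?thesis ..
qed

lemma linear_on_span_compose:
  assumes "linear_on_span e S" "linear_on_span e T"
    "\<And>x. x \<in> cvec.span (range e) \<Longrightarrow> T x \<in> cvec.span (range e)"
  shows "linear_on_span e (\<lambda>x. S (T x))"
  unfolding linear_on_span_def
  by (simp add: linear_on_spanD[OF assms(1)] linear_on_spanD[OF assms(2)] assms(3))

lemma linear_on_span_scaleR_fun:
  assumes "linear_on_span e T"
  shows "linear_on_span e (\<lambda>x. r *\<^sub>R T x)"
  unfolding linear_on_span_def
  by (simp add: linear_on_spanD[OF assms] scaleR_add_right scaleC_scaleR_commute)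

lemma linear_on_span_diff:
  assumes "linear_on_span e S" "linear_on_span e T"
  shows "linear_on_span e (\<lambda>x. S x - T x)"
  unfolding linear_on_span_def
  by (simp add: linear_on_spanD[OF assms(1)] linear_on_spanD[OF assms(2)] cvec.scale_right_diff_distrib)

lemma exp_term_linear_on_span:
  assumes "linear_on_span e T"
    "\<And>x. x \<in> cvec.span (range e) \<Longrightarrow> T x \<in> cvec.span (range e)"
  shows "linear_on_span e (\<lambda>x. exp_term T x k)"
proof -
  have "linear_on_span e (T ^^ k) \<and> (\<forall>x\<in>cvec.span (range e). (T ^^ k) x \<in> cvec.span (range e))"
  proof (induction k)
    case 0
    then show ?case by (simp add: linear_on_span_def)
  next
    case (Suc k)
    then show ?case
      using linear_on_span_compose[OF assms(1), of "T ^^ k"] assms(2) by (simp add: comp_def)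
  qed
  then show ?thesis
    unfolding exp_term_def by (simp add: linear_on_span_scaleR_fun)
qed

text \<open>Vectors of the span are finite combinations of the \<open>e n\<close>, so convergence at
  the \<open>e n\<close> is enough; the linearity of the terms then passes to the sums.\<close>

lemma exp_series_linear_on_span:
  assumes T: "linear_on_span e T"
    "\<And>x. x \<in> cvec.span (range e) \<Longrightarrow> T x \<in> cvec.span (range e)"
    and s: "\<And>n. summable (exp_term T (e n))"
  shows "x \<in> cvec.span (range e) \<Longrightarrow> summable (exp_term T x)"
    and "linear_on_span e (exp_series T)"
proof -
  have add: "exp_term T (c *\<^sub>C x + y) = (\<lambda>k. c *\<^sub>C exp_term T x k + exp_term T y k)"
    if "x \<in> cvec.span (range e)" "y \<in> cvec.span (range e)" for c x y
    using linear_on_spanD[OF exp_term_linear_on_span[OF T] that] by blast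
  show sum: "summable (exp_term T x)" if "x \<in> cvec.span (range e)" for x
  proof -
    have "x \<in> cvec.span (range e) \<and> summable (exp_term T x)"
      using that
    proof (induction rule: cvec.span_induct_alt)
      case base
      have "exp_term T 0 = (\<lambda>_. 0)"
        using linear_on_span_zero[OF exp_term_linear_on_span[OF T]] by blast
      then show ?case by (simp add: cvec.span_zero)
    next
      case (step c x y)
      then have "x \<in> cvec.span (range e)" "summable (exp_term T x)"
        using s by (auto intro: cvec.span_base)
      with step show ?case
        by (auto simp: add intro!: summable_add bounded_linear.summable[OF bounded_linear_scaleC]
            cvec.span_add cvec.span_scale)
    qed
    then show ?thesis ..
  qed
  show "linear_on_span e (exp_series T)"
    unfolding linear_on_span_def exp_series_def
    by (simp add: add sum suminf_add[symmetric] bounded_linear.summable[OF bounded_linear_scaleC]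
        bounded_linear.suminf[OF bounded_linear_scaleC])
qed

lemma linear_on_span_sum:
  assumes T: "linear_on_span e T" and x: "\<And>i. i \<in> I \<Longrightarrow> x i \<in> cvec.span (range e)"
  shows "T (\<Sum>i\<in>I. r i *\<^sub>R x i) = (\<Sum>i\<in>I. r i *\<^sub>R T (x i))"
  using x
proof (induction I rule: infinite_finite_induct)
  case (insert i I)
  then have "(\<Sum>i\<in>I. r i *\<^sub>R x i) \<in> cvec.span (range e)"
    by (intro cvec.span_sum span_scaleR) auto
  with insert show ?case
    by (simp add: linear_on_span_add[OF T] linear_on_span_scaleR[OF T] span_scaleR)
qed (simp_all add: linear_on_span_zero[OF T])

section \<open>One-parameter unitary groups and skew evolution\<close>

lemma unitary_bounded_linear:
  assumes "unitary U" shows "bounded_linear U"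
proof -
  have lin: "U (x + y) = U x + U y" "U (c *\<^sub>C x) = c *\<^sub>C U x" for x y c
    using assms by (simp_all add: unitary_def Vector_Spaces.linear_iff)
  have "complex_of_real ((norm (U x))\<^sup>2) = complex_of_real ((norm x)\<^sup>2)" for x
    using assms by (metis unitary_def cinner_self)
  then have "(norm (U x))\<^sup>2 = (norm x)\<^sup>2" for x
    by (simp only: of_real_eq_iff)
  then have "norm (U x) = norm x" for x
    by simp
  then show ?thesis
    by (intro bounded_linear_intro[where K = 1]) (simp_all add: lin scaleR_scaleC)
qed

lemma unitary_linear_on_span: "unitary U \<Longrightarrow> linear_on_span e U"
  by (simp add: unitary_def Vector_Spaces.linear_iff linear_on_span_def)

text \<open>The group law is used in both orders. Writing \<open>V (t + h)\<close> as
  \<open>V t\<close> after \<open>V h\<close> moves the limit at \<open>0\<close> through the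
  bounded map \<open>V t\<close> and gives the derivative; writing it as \<open>V h\<close> after
  \<open>V t\<close> shows that the orbit stays in the domain of the generator.\<close>

lemma unitary_group_orbit:
  assumes V: "unitary_group V" and x: "(x, y) \<in> generator V"
  shows "((\<lambda>t. V t x) has_vector_derivative V t y) (at t)" "(V t x, V t y) \<in> generator V"
proof -
  have lin: "bounded_linear (V t)"
    using V by (simp add: unitary_group_def unitary_bounded_linear)
  have "((\<lambda>h. (V h x - x) /\<^sub>R h) \<longlongrightarrow> y) (at 0)"
    using x by (simp add: generator_def)
  then have "((\<lambda>h. V t ((V h x - x) /\<^sub>R h)) \<longlongrightarrow> V t y) (at 0)"
    by (rule bounded_linear.tendsto[OF lin])
  moreover have "V t ((V h x - x) /\<^sub>R h) = (V (t + h) x - V t x) /\<^sub>R h" for h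
    using V by (simp add: unitary_group_def bounded_linear.linear[OF lin, THEN linear_scale]
        bounded_linear.linear[OF lin, THEN linear_diff])
  ultimately have lim: "((\<lambda>h. (V (t + h) x - V t x) /\<^sub>R h) \<longlongrightarrow> V t y) (at 0)"
    by simp
  moreover have "V (t + h) x = V h (V t x)" for h
    using V by (metis add.commute comp_apply unitary_group_def)
  ultimately show "(V t x, V t y) \<in> generator V"
    by (simp add: generator_def)
  \<comment> \<open>The difference quotient is turned into the remainder form of
    \<open>has_derivative_at\<close>.\<close>
  have "norm (V (t + h) x - V t x - h *\<^sub>R V t y) / norm h = norm ((V (t + h) x - V t x) /\<^sub>R h - V t y)"
    if "h \<noteq> 0" for h
  proof -
    have "V (t + h) x - V t x - h *\<^sub>R V t y = h *\<^sub>R ((V (t + h) x - V t x) /\<^sub>R h - V t y)"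
      using that by (simp add: scaleR_diff_right)
    then show ?thesis using that by simp
  qed
  then have "((\<lambda>h. norm (V (t + h) x - V t x - h *\<^sub>R V t y) / norm h) \<longlongrightarrow> 0) (at 0)"
    using tendsto_norm_zero[OF LIM_zero[OF lim]]
    by (subst tendsto_cong) (auto simp: eventually_at_filter)
  then show "((\<lambda>t. V t x) has_vector_derivative V t y) (at t)"
    by (simp add: has_vector_derivative_def has_derivative_at bounded_linear_scaleR_left)
qed

lemma subspace_closure:
  fixes S :: "'a :: real_normed_vector set"
  assumes "subspace S" shows "subspace (closure S)"
  unfolding subspace_def
proof (intro conjI ballI allI)
  show "0 \<in> closure S"
    using assms closure_subset subspace_0 by blast
  fix x assume "x \<in> closure S"
  then obtain u where u: "\<And>n. u n \<in> S" "u \<longlonglongrightarrow> x" by (auto simp: closure_sequential)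
  show "c *\<^sub>R x \<in> closure S" for c
    unfolding closure_sequential using u assms
    by (intro exI[of _ "\<lambda>n. c *\<^sub>R u n"]) (auto intro: subspace_scale tendsto_intros)
  fix y assume "y \<in> closure S"
  then obtain v where v: "\<And>n. v n \<in> S" "v \<longlonglongrightarrow> y" by (auto simp: closure_sequential)
  show "x + y \<in> closure S"
    unfolding closure_sequential using u v assms
    by (intro exI[of _ "\<lambda>n. u n + v n"]) (auto intro: subspace_add tendsto_intros)
qed

text \<open>The derivative of the squared norm is twice \<open>Re (cinner (z t) (z' t))\<close>, so
  the norm keeps its initial value.\<close>

lemma skew_evolution_zero:
  fixes z :: "real \<Rightarrow> 'a :: complex_hilbert"
  assumes z: "\<And>t. (z has_vector_derivative z' t) (at t)"
    and skew: "\<And>t. Re (cinner (z t) (z' t)) = 0" and z0: "z 0 = 0"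
  shows "z t = 0"
proof -
  have "((\<lambda>t. Re (cinner (z t) (z t))) has_vector_derivative 0) (at t)" for t
    using bounded_bilinear.has_vector_derivative[OF bounded_bilinear_Re_cinner z z, of t]
    by (simp add: skew Re_cinner_commute[of "z' t"])
  then have "Re (cinner (z t) (z t)) = Re (cinner (z 0) (z 0))"
    by (intro DERIV_isconst_all) (auto simp: has_real_derivative_iff_has_vector_derivative)
  then show ?thesis
    by (simp add: z0 cinner_self)
qed

section \<open>Ladder operators on the span of the basis\<close>

locale oscillator =
  fixes e :: "nat \<Rightarrow> 'a :: complex_hilbert"
  assumes basis: "orthonormal_basis e"
begin

abbreviation "D \<equiv> cvec.span (range e)"
abbreviation "a \<equiv> annihilation e"
abbreviation "a' \<equiv> creation e"

lemma cinner_basis: "cinner (e m) (e n) = (if m = n then 1 else 0)"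
  using basis by (simp add: orthonormal_basis_def)

lemma norm_basis: "norm (e n) = 1"
proof -
  have "complex_of_real ((norm (e n))\<^sup>2) = complex_of_real 1"
    by (simp only: cinner_self[symmetric] cinner_basis) simp
  then have "(norm (e n))\<^sup>2 = 1" by (simp only: of_real_eq_iff)
  then show ?thesis using norm_ge_zero[of "e n"] by (auto simp: power2_eq_1_iff simp del: norm_ge_zero)
qed

lemma basis_in_span: "e n \<in> D"
  by (simp add: cvec.span_base)

lemma finite_coeff: "x \<in> D \<Longrightarrow> finite {n. cinner (e n) x \<noteq> 0}"
proof (induction rule: cvec.span_induct_alt)
  case (step c x y)
  then obtain m where "x = e m" by auto
  then have "{n. cinner (e n) (c *\<^sub>C x + y) \<noteq> 0} \<subseteq> insert m {n. cinner (e n) y \<noteq> 0}"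
    by (auto simp: cinner_add_right cinner_scaleC_right cinner_basis split: if_splits)
  with step show ?case by (meson finite_insert finite_subset)
qed simp

text \<open>This is the common form of the two ladder operators and \<open>exp_number\<close>; by
  \<open>finite_coeff\<close> the series is a finite sum on \<open>D\<close>.\<close>

lemma basis_series_linear: "linear_on_span e (\<lambda>x. \<Sum>n. (c n * cinner (e n) x) *\<^sub>C f n)"
proof -
  have "summable (\<lambda>n. (c n * cinner (e n) x) *\<^sub>C f n)" if "x \<in> D" for x
    by (rule summable_finite[OF finite_coeff[OF that]]) simp
  then have sums: "(\<lambda>n. (c n * cinner (e n) x) *\<^sub>C f n) sums (\<Sum>n. (c n * cinner (e n) x) *\<^sub>C f n)"
    if "x \<in> D" for x
    using that by (intro summable_sums)
  have "(c n * cinner (e n) (k *\<^sub>C x + y)) *\<^sub>C f n =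
      k *\<^sub>C (c n * cinner (e n) x) *\<^sub>C f n + (c n * cinner (e n) y) *\<^sub>C f n" for k x y n
    by (simp add: cinner_add_right cinner_scaleC_right distrib_left scaleC_add_left scaleC_scaleC
        mult.left_commute)
  then show ?thesis
    unfolding linear_on_span_def
    by (auto intro!: sums_unique[symmetric] simp only:)
      (intro sums_add bounded_linear.sums[OF bounded_linear_scaleC] sums)
qed

lemma annihilation_linear: "linear_on_span e a"
  and creation_linear: "linear_on_span e a'"
  and exp_number_linear: "linear_on_span e (exp_number e \<beta>)"
  using basis_series_linear unfolding annihilation_def creation_def exp_number_def by auto

text \<open>The unnormalised vectors \<open>(a' ^^ n) (e 0)\<close>, on which the ladder operators act without square roots.\<close>

definition f :: "nat \<Rightarrow> 'a" where "f n = sqrt (fact n) *\<^sub>R e n"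

lemma f_in_span: "f n \<in> D"
  by (simp add: f_def span_scaleR basis_in_span)

lemma basis_eq_f: "e n = (1 / sqrt (fact n)) *\<^sub>R f n"
  by (simp add: f_def)

lemma norm_f: "norm (f n) = sqrt (fact n)"
  by (simp add: f_def norm_basis)

text \<open>At \<open>n = 0\<close> the truncated index \<open>n - 1\<close> is harmless, as the
  factor \<open>real n\<close> vanishes.\<close>

lemma annihilation_f: "a (f n) = real n *\<^sub>R f (n - 1)"
proof (cases n)
  case 0
  then show ?thesis
    by (simp add: f_def linear_on_span_scaleR[OF annihilation_linear basis_in_span] annihilation_basis_0[OF basis])
next
  case (Suc k)
  have "sqrt (real (Suc k) * fact k) * sqrt (real (Suc k)) = real (Suc k) * sqrt (fact k)"
    by (simp add: real_sqrt_mult)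
  with Suc show ?thesis
    by (simp add: f_def linear_on_span_scaleR[OF annihilation_linear basis_in_span]
        annihilation_basis_Suc[OF basis] add.commute)
qed

lemma creation_f: "a' (f n) = f (Suc n)"
  by (simp add: f_def linear_on_span_scaleR[OF creation_linear basis_in_span]
      creation_basis[OF basis] real_sqrt_mult add.commute mult.commute)

lemma exp_number_f: "exp_number e \<beta> (f n) = exp (\<beta> * (n + 1/2)) *\<^sub>R f n"
  by (simp add: f_def linear_on_span_scaleR[OF exp_number_linear basis_in_span]
      exp_number_basis[OF basis] mult.commute)

lemma annihilation_basis_in_span: "a (e n) \<in> D"
  unfolding basis_eq_f[of n] linear_on_span_scaleR[OF annihilation_linear f_in_span] annihilation_f
  by (intro span_scaleR f_in_span)

lemma annihilation_in_span: "x \<in> D \<Longrightarrow> a x \<in> D"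
  by (rule linear_on_span_in_span[OF annihilation_linear])
    (rule annihilation_basis_in_span)

lemma creation_in_span: "x \<in> D \<Longrightarrow> a' x \<in> D"
  by (rule linear_on_span_in_span[OF creation_linear])
    (simp add: creation_basis[OF basis] span_scaleR basis_in_span)

lemma exp_number_in_span: "x \<in> D \<Longrightarrow> exp_number e \<beta> x \<in> D"
  by (rule linear_on_span_in_span[OF exp_number_linear])
    (simp add: exp_number_basis[OF basis] span_scaleR basis_in_span)

lemma annihilation2_linear: "linear_on_span e (\<lambda>x. a (a x))"
  by (rule linear_on_span_compose[OF annihilation_linear annihilation_linear annihilation_in_span])

lemma creation2_linear: "linear_on_span e (\<lambda>x. a' (a' x))"
  by (rule linear_on_span_compose[OF creation_linear creation_linear creation_in_span])

lemma annihilation2_f: "a (a (f n)) = (real n * real (n - 1)) *\<^sub>R f (n - 2)"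
  by (simp add: annihilation_f linear_on_span_scaleR[OF annihilation_linear f_in_span] numeral_2_eq_2)

lemma creation2_f: "a' (a' (f n)) = f (n + 2)"
  by (simp add: creation_f)

text \<open>Adjointness is checked on basis vectors, then extended in the linear second argument and
  finally in the antilinear first one.\<close>

lemma cinner_annihilation:
  assumes "x \<in> D" "y \<in> D"
  shows "cinner x (a y) = cinner (a' x) y"
proof -
  have *: "cinner (e i) (a (e j)) = cinner (a' (e i)) (e j)" for i j
    by (cases j) (auto simp: annihilation_basis_0[OF basis] annihilation_basis_Suc[OF basis]
        creation_basis[OF basis] cinner_scaleR_left cinner_scaleR_right cinner_basis)
  have **: "y \<in> D \<and> cinner (e i) (a y) = cinner (a' (e i)) y" for i
    using assms(2)
  proof (induction rule: cvec.span_induct_alt)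
    case (step c x y)
    then show ?case
      using * by (auto simp: linear_on_spanD[OF annihilation_linear] cvec.span_base cvec.span_add cvec.span_scale
          cinner_add_right cinner_scaleC_right)
  qed (simp add: linear_on_span_zero[OF annihilation_linear] cvec.span_zero)
  have "x \<in> D \<and> cinner x (a y) = cinner (a' x) y"
    using assms(1)
  proof (induction rule: cvec.span_induct_alt)
    case (step c x y)
    then show ?case
      using ** by (auto simp: linear_on_spanD[OF creation_linear] cvec.span_base cvec.span_add cvec.span_scale
          cinner_add_left cinner_scaleC_left)
  qed (simp add: linear_on_span_zero[OF creation_linear] cvec.span_zero)
  then show ?thesis ..
qed

text \<open>By adjointness the inner products of \<open>x\<close> with \<open>a (a x)\<close> and
  with \<open>a' (a' x)\<close> are complex conjugates, so their difference is purely
  imaginary.\<close>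

lemma generator_skew:
  assumes "x \<in> D"
  shows "Re (cinner x (l *\<^sub>R (a (a x) - a' (a' x)))) = 0"
proof -
  have "cinner x (a (a x)) = cinner (a' (a' x)) x"
    by (simp add: cinner_annihilation assms annihilation_in_span creation_in_span)
  then show ?thesis
    by (simp add: cinner_scaleR_right cinner_diff_right Re_cinner_commute[of "a' (a' x)"])
qed

section \<open>Terms of the exponential series on the vectors \<open>f n\<close>\<close>

text \<open>Each step lowers the index by two and adds two factors to the falling factorial. For
  \<open>2 * k > m\<close> its factor at \<open>i = m\<close> is zero, so the truncation of
  \<open>m - 2 * k\<close> does no harm.\<close>

lemma exp_term_annihilation:
  "exp_term (\<lambda>y. r *\<^sub>R a (a y)) (f m) k = (r ^ k / fact k * (\<Prod>i<2*k. real m - real i)) *\<^sub>R f (m - 2 * k)"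
proof -
  have "((\<lambda>y. r *\<^sub>R a (a y)) ^^ k) (f m) = (r ^ k * (\<Prod>i<2*k. real m - real i)) *\<^sub>R f (m - 2 * k)"
  proof (induction k)
    case (Suc k)
    show ?case
    proof (cases "2 * k \<le> m")
      case True
      have "real (m - 2 * k) * real (m - 2 * k - 1) = (real m - real (2 * k)) * (real m - real (Suc (2 * k)))"
        using True by (cases "m = 2 * k") (auto simp: of_nat_diff)
      then show ?thesis
        using Suc by (simp add: linear_on_span_scaleR[OF annihilation2_linear f_in_span] annihilation2_f)
    next
      case False
      then have "(\<Prod>i<2*k. real m - real i) = 0"
        by (intro prod_zero) auto
      with Suc show ?thesis
        by (simp add: linear_on_span_zero[OF annihilation2_linear])
    qed
  qed simp
  then show ?thesis
    by (simp add: exp_term_def divide_inverse)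
qed

lemma exp_term_creation:
  "exp_term (\<lambda>y. r *\<^sub>R a' (a' y)) (f n) k = (r ^ k / fact k) *\<^sub>R f (n + 2 * k)"
proof -
  have "((\<lambda>y. r *\<^sub>R a' (a' y)) ^^ k) (f n) = r ^ k *\<^sub>R f (n + 2 * k)"
    by (induction k) (simp_all add: linear_on_span_scaleR[OF creation2_linear f_in_span] creation2_f)
  then show ?thesis
    by (simp add: exp_term_def divide_inverse_commute)
qed

section \<open>The vectors \<open>G n x\<close> and their derivative in \<open>x\<close>\<close>

text \<open>For \<open>\<bar>x\<bar> < 1/2\<close> the vector \<open>G 0 x\<close> is an
  unnormalised squeezed vacuum.\<close>

definition G :: "nat \<Rightarrow> real \<Rightarrow> 'a" where
  "G n x = exp_series (\<lambda>y. (- x) *\<^sub>R a' (a' y)) (f n)"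

text \<open>These are the norms of the terms of \<open>G n r\<close>. The ratio of consecutive terms
  tends to \<open>2 * r\<close>, whence the bound \<open>1/2\<close>.\<close>

lemma majorant_summable:
  assumes "0 \<le> r" "r < 1/2"
  shows "summable (\<lambda>k. r ^ k / fact k * sqrt (fact (n + 2 * k)))"
proof (rule summable_ratio_test)
  \<comment> \<open>The midpoint between the limiting ratio \<open>2 * r\<close> and
    \<open>1\<close>.\<close>
  define c where "c = r + 1/2"
  show "c < 1" using assms by (simp add: c_def)
  \<comment> \<open>The threshold is chosen to ensure the estimate \<open>rk\<close> below.\<close>
  fix k assume k: "k \<ge> nat \<lceil>r * real n / (1/2 - r)\<rceil>"
  have "r * real n / (1/2 - r) \<le> real k" using k by linarith
  then have "r * real n \<le> (1/2 - r) * real k"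
    using assms by (simp add: divide_le_eq mult.commute)
  then have rk: "r * (real n + 2 * real k + 2) \<le> c * (real k + 1)"
    using assms by (simp add: c_def algebra_simps)
  have "sqrt (fact (n + 2 * Suc k)) =
      sqrt ((real n + 2 * real k + 2) * (real n + 2 * real k + 1)) * sqrt (fact (n + 2 * k))"
    by (simp add: real_sqrt_mult[symmetric] algebra_simps)
  also have "\<dots> \<le> (real n + 2 * real k + 2) * sqrt (fact (n + 2 * k))"
    by (intro mult_right_mono real_le_lsqrt) (auto simp: power2_eq_square intro!: mult_left_mono)
  finally have "r ^ Suc k / fact (Suc k) * sqrt (fact (n + 2 * Suc k)) \<le>
      r ^ Suc k / fact (Suc k) * ((real n + 2 * real k + 2) * sqrt (fact (n + 2 * k)))"
    using assms by (intro mult_left_mono) auto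
  also have "\<dots> = (r * (real n + 2 * real k + 2)) / (real k + 1) * (r ^ k / fact k * sqrt (fact (n + 2 * k)))"
    by (simp add: field_simps)
  also have "\<dots> \<le> c * (r ^ k / fact k * sqrt (fact (n + 2 * k)))"
    using assms rk by (intro mult_right_mono) (auto simp: divide_le_eq)
  finally show "norm (r ^ Suc k / fact (Suc k) * sqrt (fact (n + 2 * Suc k)))
      \<le> c * norm (r ^ k / fact k * sqrt (fact (n + 2 * k)))"
    using assms by (simp add: abs_mult)
qed

lemma G_summable:
  assumes "\<bar>x\<bar> < 1/2"
  shows "summable (\<lambda>k. ((- x) ^ k / fact k) *\<^sub>R f (n + 2 * k))"
  by (rule summable_comparison_test'[OF majorant_summable[of "\<bar>x\<bar>" n]])
    (use assms in \<open>auto simp: norm_f power_abs abs_mult\<close>)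

lemma G_sums:
  assumes "\<bar>x\<bar> < 1/2"
  shows "(\<lambda>k. ((- x) ^ k / fact k) *\<^sub>R f (n + 2 * k)) sums G n x"
  unfolding G_def exp_series_def exp_term_creation
  using summable_sums[OF G_summable[OF assms]] by simp

lemma G_zero: "G n 0 = f n"
proof -
  have "(\<lambda>k. ((- 0) ^ k / fact k) *\<^sub>R f (n + 2 * k)) sums f n"
    using sums_finite[of "{0}" "\<lambda>k. ((- 0) ^ k / fact k) *\<^sub>R f (n + 2 * k)"]
    by (simp add: power_0_left)
  then show ?thesis
    using G_sums[of 0 n] by (simp add: sums_unique2)
qed

text \<open>Differentiating term \<open>k\<close> of \<open>G n\<close> gives minus term
  \<open>k - 1\<close> of \<open>G (n + 2)\<close>. The differentiated series converges uniformly
  near \<open>x\<close>, so it may be summed.\<close>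

lemma G_deriv:
  assumes "\<bar>x\<bar> < 1/2"
  shows "(G n has_vector_derivative - G (n + 2) x) (at x)"
proof -
  \<comment> \<open>The room between \<open>\<bar>x\<bar>\<close> and \<open>1/2\<close> lets one
    majorant, with parameter \<open>r\<close>, serve a whole neighbourhood of
    \<open>x\<close>.\<close>
  obtain r where r: "\<bar>x\<bar> < r" "r < 1/2" using assms dense by blast
  define S where "S = {-r<..<r}"
  have S: "\<bar>y\<bar> < 1/2" "\<bar>y\<bar> \<le> r" if "y \<in> S" for y using that r by (auto simp: S_def)
  \<comment> \<open>\<open>d k\<close> is the derivative of term \<open>k\<close>; the constant term
    contributes zero, which shifts the index by one.\<close>
  define d where "d k y = (case k of 0 \<Rightarrow> 0
      | Suc j \<Rightarrow> (- ((- y) ^ j / fact j)) *\<^sub>R f (n + 2 + 2 * j))" for k y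
  define M where "M k = (case k of 0 \<Rightarrow> 0
      | Suc j \<Rightarrow> r ^ j / fact j * sqrt (fact (n + 2 + 2 * j)))" for k
  have d_sums: "(\<lambda>k. d k y) sums (- G (n + 2) y)" if "y \<in> S" for y
    by (rule sums_Suc_imp[where f = "\<lambda>k. d k y"])
      (use sums_minus[OF G_sums[OF S(1)[OF that], of "n + 2"]] in \<open>simp_all add: d_def\<close>)
  have "summable M"
    using majorant_summable[of r "n + 2"] r by (subst summable_Suc_iff[symmetric]) (simp add: M_def)
  moreover have "norm (d k y) \<le> M k" if "y \<in> S" for k y
    using S(2)[OF that]
    by (cases k) (auto simp: d_def M_def norm_f power_abs abs_mult
        intro!: mult_right_mono divide_right_mono power_mono)
  ultimately have "uniform_limit S (\<lambda>N y. \<Sum>k<N. d k y) (\<lambda>y. \<Sum>k. d k y) sequentially"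
    by (intro Weierstrass_m_test)
  then have lim: "uniform_limit S (\<lambda>N y. \<Sum>k<N. d k y) (\<lambda>y. - G (n + 2) y) sequentially"
    by (rule uniform_limit_cong'[THEN iffD1, rotated -1]) (simp_all add: sums_unique[OF d_sums, symmetric])
  have x: "x \<in> S" using r by (auto simp: S_def)
  have "\<exists>g. \<forall>y\<in>S. (\<lambda>k. ((- y) ^ k / fact k) *\<^sub>R f (n + 2 * k)) sums g y \<and>
      (g has_derivative (\<lambda>h. h *\<^sub>R (- G (n + 2) y))) (at y within S)"
  proof (rule has_derivative_series)
    show "convex S" by (simp add: S_def)
    show "((\<lambda>y. ((- y) ^ k / fact k) *\<^sub>R f (n + 2 * k)) has_derivative (\<lambda>h. h *\<^sub>R d k y)) (at y within S)" for k y
    proof (cases k)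
      case (Suc j)
      have "((\<lambda>y. (- y) ^ k / fact k) has_real_derivative (- ((- y) ^ j / fact j))) (at y within S)"
      proof -
        have "((\<lambda>y. (- y) ^ Suc j) has_real_derivative (real (Suc j) * (- ((- y) ^ j)))) (at y within S)"
          using DERIV_power_Suc[OF DERIV_minus[OF DERIV_ident], of j y S] by (simp add: mult_ac)
        from DERIV_cdivide[OF this, of "fact (Suc j)"] show ?thesis
          by (simp only: Suc fact_Suc of_nat_mult of_nat_fact mult_divide_mult_cancel_left of_nat_eq_0_iff
              nat.distinct simp_thms minus_divide_left[symmetric] mult_minus_right)
      qed
      from has_vector_derivative_scaleR[OF this has_vector_derivative_const] show ?thesis
        by (simp add: d_def Suc has_vector_derivative_def)
    qed (simp add: d_def)
    show "\<forall>\<^sub>F N in sequentially. \<forall>y\<in>S. \<forall>h. norm ((\<Sum>i<N. h *\<^sub>R d i y) - h *\<^sub>R (- G (n + 2) y)) \<le> e * norm h"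
      if "e > 0" for e
      using uniform_limitD[OF lim that]
    proof eventually_elim
      case (elim N)
      show ?case
      proof (intro ballI allI)
        fix y h assume "y \<in> S"
        then have "norm ((\<Sum>i<N. d i y) - (- G (n + 2) y)) \<le> e"
          using elim by (auto simp: dist_norm less_imp_le)
        then have "\<bar>h\<bar> * norm ((\<Sum>i<N. d i y) - (- G (n + 2) y)) \<le> \<bar>h\<bar> * e"
          by (rule mult_left_mono) simp
        then show "norm ((\<Sum>i<N. h *\<^sub>R d i y) - h *\<^sub>R (- G (n + 2) y)) \<le> e * norm h"
          by (simp only: scaleR_sum_right[symmetric] scaleR_diff_right[symmetric] norm_scaleR
              real_norm_def mult.commute)
      qed
    qed
    show "x \<in> S" by (rule x)
    show "(\<lambda>k. ((- x) ^ k / fact k) *\<^sub>R f (n + 2 * k)) sums G n x"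
      by (rule G_sums[OF assms])
  qed
  then obtain g where g: "\<And>y. y \<in> S \<Longrightarrow> (\<lambda>k. ((- y) ^ k / fact k) *\<^sub>R f (n + 2 * k)) sums g y"
      "(g has_vector_derivative - G (n + 2) x) (at x within S)"
    using x unfolding has_vector_derivative_def by blast
  \<comment> \<open>The theorem on series only yields some limit function; uniqueness of sums
    identifies it.\<close>
  have "g y = G n y" if "y \<in> S" for y
    using g(1)[OF that] G_sums[OF S(1)[OF that]] by (rule sums_unique2)
  with g(2) x have "(G n has_vector_derivative - G (n + 2) x) (at x within S)"
    by (metis has_vector_derivative_transform)
  then show ?thesis
    using x by (simp add: S_def at_within_open[OF _ open_greaterThanLessThan])
qed

section \<open>The closure of the generator\<close>

definition C :: "real \<Rightarrow> ('a \<times> 'a) set" where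
  "C l = closure (operator_graph D (\<lambda>x. l *\<^sub>R (a (a x) - a' (a' x))))"

lemma generator_linear: "linear_on_span e (\<lambda>x. l *\<^sub>R (a (a x) - a' (a' x)))"
  by (rule linear_on_span_scaleR_fun[OF linear_on_span_diff[OF annihilation2_linear creation2_linear]])

lemma C_subspace: "subspace (C l)"
  unfolding C_def
proof (rule subspace_closure, unfold subspace_def operator_graph_def, intro conjI ballI allI)
  let ?T = "\<lambda>x. l *\<^sub>R (a (a x) - a' (a' x))"
  show "0 \<in> (\<lambda>x. (x, ?T x)) ` D"
    using linear_on_span_zero[OF generator_linear, of l]
    by (intro image_eqI[of _ _ 0]) (auto simp: cvec.span_zero zero_prod_def)
  show "p + q \<in> (\<lambda>x. (x, ?T x)) ` D" if "p \<in> (\<lambda>x. (x, ?T x)) ` D" "q \<in> (\<lambda>x. (x, ?T x)) ` D" for p q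
    using that linear_on_span_add[OF generator_linear, of _ _ l]
    by (auto intro!: image_eqI[of _ _ "_ + _"] simp: cvec.span_add)
  show "c *\<^sub>R p \<in> (\<lambda>x. (x, ?T x)) ` D" if "p \<in> (\<lambda>x. (x, ?T x)) ` D" for c p
    using that linear_on_span_scaleR[OF generator_linear, of _ l c]
    by (auto intro!: image_eqI[of _ _ "c *\<^sub>R _"] simp: span_scaleR)
qed

text \<open>The condition is closed in the product space because the form is continuous, so it
  passes from the graph to its closure.\<close>

lemma C_skew:
  assumes "(x, y) \<in> C l" shows "Re (cinner x y) = 0"
proof -
  have "closed {p :: 'a \<times> 'a. Re (cinner (fst p) (snd p)) = 0}"
    by (intro closed_Collect_eq continuous_intros
        bounded_bilinear.continuous_on[OF bounded_bilinear_Re_cinner])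
  then have "C l \<subseteq> {p. Re (cinner (fst p) (snd p)) = 0}"
    unfolding C_def by (intro closure_minimal) (auto simp: operator_graph_def generator_skew)
  with assms show ?thesis by auto
qed


text \<open>The partial sums of \<open>G n x\<close> lie in \<open>D\<close> and their images
  converge, so the pair of limits lies in the closure. The images are summed by splitting
  \<open>(n + 2*k) * (n + 2*k - 1)\<close> into
  \<open>n * (n - 1) + (4*n + 2) * k + 4 * k * (k - 1)\<close>: the factors \<open>k\<close> and
  \<open>k * (k - 1)\<close> cancel against the factorial in \<open>c k\<close> and shift the index
  by one and two.\<close>

lemma G_in_domain:
  assumes x: "\<bar>x\<bar> < 1/2"
  shows "(G n x, l *\<^sub>R ((real n * real (n - 1)) *\<^sub>R G (n - 2) x - (4 * x * (n + 1/2)) *\<^sub>R G n x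
      - (1 - 4 * x\<^sup>2) *\<^sub>R G (n + 2) x)) \<in> C l"
proof -
  let ?T = "\<lambda>x. l *\<^sub>R (a (a x) - a' (a' x))"
  define c where "c k = (- x) ^ k / fact k" for k
  have c_Suc: "real (Suc k) * c (Suc k) = - x * c k" for k
    unfolding c_def fact_Suc by (simp del: of_nat_Suc)
  have sums: "(\<lambda>k. c k *\<^sub>R f (m + 2 * k)) sums G m x" for m
    unfolding c_def by (rule G_sums[OF x])
  \<comment> \<open>The term \<open>k = 0\<close>, where the index may truncate, has coefficient
    zero.\<close>
  have lower: "(\<lambda>k. (real k * c k) *\<^sub>R f (n + 2 * k - 2)) sums ((- x) *\<^sub>R G n x)"
  proof (rule sums_Suc_imp)
    show "(\<lambda>k. (real (Suc k) * c (Suc k)) *\<^sub>R f (n + 2 * Suc k - 2)) sums ((- x) *\<^sub>R G n x)"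
      using sums_scaleR_right[OF sums, of "- x" n] unfolding c_Suc by simp
  qed simp
  \<comment> \<open>This is \<open>lower2\<close> after one index shift; a second shift removes the
    remaining factor \<open>k\<close>.\<close>
  have "(\<lambda>k. (real k * (real (Suc k) * c (Suc k))) *\<^sub>R f (n + 2 * k)) sums (x\<^sup>2 *\<^sub>R G (n + 2) x)"
  proof -
    have *: "real (Suc k) * (real (Suc (Suc k)) * c (Suc (Suc k))) = x\<^sup>2 * c k" for k
    proof -
      have "real (Suc k) * (real (Suc (Suc k)) * c (Suc (Suc k))) = - x * (real (Suc k) * c (Suc k))"
        by (simp only: c_Suc[of "Suc k"]) (simp del: of_nat_Suc)
      then show ?thesis by (simp only: c_Suc) (simp add: power2_eq_square)
    qed
    show ?thesis
    proof (rule sums_Suc_imp)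
      show "(\<lambda>k. (real (Suc k) * (real (Suc (Suc k)) * c (Suc (Suc k)))) *\<^sub>R f (n + 2 * Suc k))
          sums (x\<^sup>2 *\<^sub>R G (n + 2) x)"
        using sums_scaleR_right[OF sums, of "x\<^sup>2" "n + 2"] unfolding * by simp
    qed simp
  qed
  then have lower2: "(\<lambda>k. (real k * (real k - 1) * c k) *\<^sub>R f (n + 2 * k - 2)) sums (x\<^sup>2 *\<^sub>R G (n + 2) x)"
    by (intro sums_Suc_imp[where f = "\<lambda>k. (real k * (real k - 1) * c k) *\<^sub>R f (n + 2 * k - 2)"])
      (simp_all add: mult_ac)
  have T_f: "?T (c k *\<^sub>R f (n + 2 * k)) = l *\<^sub>R ((real n * real (n - 1)) *\<^sub>R (c k *\<^sub>R f (n - 2 + 2 * k))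
      + (4 * n + 2) *\<^sub>R ((real k * c k) *\<^sub>R f (n + 2 * k - 2))
      + 4 *\<^sub>R ((real k * (real k - 1) * c k) *\<^sub>R f (n + 2 * k - 2))
      - c k *\<^sub>R f (n + 2 + 2 * k))" for k
  proof -
    have "real (n + 2 * k) * real (n + 2 * k - 1) =
        real n * real (n - 1) + (4 * n + 2) * real k + 4 * (real k * (real k - 1))"
      by (cases n; cases k) (auto simp: algebra_simps)
    \<comment> \<open>For \<open>n < 2\<close> the two indices can differ by truncation, but then
      the coefficient is zero.\<close>
    moreover have "(real n * real (n - 1)) *\<^sub>R f (n - 2 + 2 * k) = (real n * real (n - 1)) *\<^sub>R f (n + 2 * k - 2)"
    proof (cases "n < 2")
      case True
      then have "real n * real (n - 1) = 0" by (cases n) auto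
      then show ?thesis by (simp only: scaleR_zero_left)
    qed simp
    ultimately show ?thesis
      by (simp only: linear_on_span_scaleR[OF generator_linear f_in_span] annihilation2_f creation2_f
          scaleR_left_distrib scaleR_left_commute[of "real n * real (n - 1)" "c k"])
        (simp add: algebra_simps)
  qed
  have "(\<lambda>k. ?T (c k *\<^sub>R f (n + 2 * k))) sums (l *\<^sub>R ((real n * real (n - 1)) *\<^sub>R G (n - 2) x
      + (4 * n + 2) *\<^sub>R ((- x) *\<^sub>R G n x) + 4 *\<^sub>R (x\<^sup>2 *\<^sub>R G (n + 2) x) - G (n + 2) x))"
    unfolding T_f by (intro sums_scaleR_right sums_diff sums_add sums lower lower2)
  then have "(\<lambda>N. \<Sum>k<N. ?T (c k *\<^sub>R f (n + 2 * k))) \<longlonglongrightarrow>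
      l *\<^sub>R ((real n * real (n - 1)) *\<^sub>R G (n - 2) x - (4 * x * (n + 1/2)) *\<^sub>R G n x
      - (1 - 4 * x\<^sup>2) *\<^sub>R G (n + 2) x)" (is "_ \<longlonglongrightarrow> ?y")
    unfolding sums_def by (simp add: algebra_simps)
  moreover have "(\<lambda>N. \<Sum>k<N. c k *\<^sub>R f (n + 2 * k)) \<longlonglongrightarrow> G n x"
    using sums by (simp add: sums_def)
  ultimately have lim: "(\<lambda>N. (\<Sum>k<N. c k *\<^sub>R f (n + 2 * k), \<Sum>k<N. ?T (c k *\<^sub>R f (n + 2 * k))))
      \<longlonglongrightarrow> (G n x, ?y)"
    by (intro tendsto_Pair)
  have mem: "(\<Sum>k<N. c k *\<^sub>R f (n + 2 * k), \<Sum>k<N. ?T (c k *\<^sub>R f (n + 2 * k)))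
      \<in> operator_graph D ?T" for N
  proof -
    have "(\<Sum>k<N. ?T (c k *\<^sub>R f (n + 2 * k))) = ?T (\<Sum>k<N. c k *\<^sub>R f (n + 2 * k))"
      unfolding linear_on_span_sum[OF generator_linear f_in_span]
      by (simp only: linear_on_span_scaleR[OF generator_linear f_in_span])
    moreover have "(\<Sum>k<N. c k *\<^sub>R f (n + 2 * k)) \<in> D"
      by (intro cvec.span_sum span_scaleR f_in_span)
    ultimately show ?thesis
      by (simp only: operator_graph_def) blast
  qed
  show ?thesis
    unfolding C_def closure_sequential by (rule exI, rule conjI[OF _ lim], rule allI, rule mem)
qed

section \<open>The product of exponentials along the path and its evolution equation\<close>

text \<open>The falling factorial vanishes for \<open>2 * j > m\<close>, where \<open>m - 2 * j\<close> is truncated; so \<open>W l m t\<close> is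
  the product of the three exponentials at parameter \<open>l * t\<close>, applied to \<open>f m\<close>.\<close>

definition q :: "real \<Rightarrow> nat \<Rightarrow> nat \<Rightarrow> real \<Rightarrow> real" where
  "q l m j t = (tanh (2 * l * t) / 2) ^ j / fact j * (\<Prod>i<2*j. real m - real i) *
     exp (- ln (cosh (2 * l * t)) * (real (m - 2 * j) + 1/2))"

definition W :: "real \<Rightarrow> nat \<Rightarrow> real \<Rightarrow> 'a" where
  "W l m t = (\<Sum>j<Suc m. q l m j t *\<^sub>R G (m - 2 * j) (tanh (2 * l * t) / 2))"

lemma exp_series_annihilation_f:
  assumes "\<bar>\<gamma>\<bar> < 1/2"
  shows "summable (exp_term (\<lambda>y. \<gamma> *\<^sub>R a (a y)) (f m))"
    and "exp_series (\<lambda>y. \<gamma> *\<^sub>R a (a y)) (f m) =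
      (\<Sum>j<Suc m. (\<gamma> ^ j / fact j * (\<Prod>i<2*j. real m - real i)) *\<^sub>R f (m - 2 * j))"
proof -
  have "exp_term (\<lambda>y. \<gamma> *\<^sub>R a (a y)) (f m) k = 0" if "k \<notin> {..<Suc m}" for k
  proof -
    have "(\<Prod>i<2*k. real m - real i) = 0"
      using that by (intro prod_zero) auto
    then show ?thesis by (simp add: exp_term_annihilation)
  qed
  then show "summable (exp_term (\<lambda>y. \<gamma> *\<^sub>R a (a y)) (f m))"
    "exp_series (\<lambda>y. \<gamma> *\<^sub>R a (a y)) (f m) =
      (\<Sum>j<Suc m. (\<gamma> ^ j / fact j * (\<Prod>i<2*j. real m - real i)) *\<^sub>R f (m - 2 * j))"
    unfolding exp_series_def
    by (auto simp only: exp_term_annihilation[symmetric] intro!: summable_finite[of "{..<Suc m}"]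
        suminf_finite[of "{..<Suc m}"])
qed

lemma tanh_bound: "\<bar>tanh (x :: real) / 2\<bar> < 1/2"
  using tanh_real_bounds[of x] by auto

text \<open>The product rule yields three kinds of terms, matched with \<open>G_in_domain\<close>:
  the derivative of \<open>G\<close> gives the raising term, that of the exponential factor the
  diagonal term, and that of the powers of \<open>g t\<close>, after a shift of \<open>j\<close>,
  the lowering term.\<close>

lemma W_evolution:
  "\<exists>y. (W l m has_vector_derivative y) (at t) \<and> (W l m t, y) \<in> C l"
proof -
  define g where "g t = tanh (2 * l * t) / 2" for t
  define b where "b t = - ln (cosh (2 * l * t))" for t
  define n where "n j = m - 2 * j" for j
  define c where "c j = (\<Prod>i<2*j. real m - real i) / fact j" for j
  \<comment> \<open>The part of the derivative of \<open>q l m j\<close> that comes from the power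
    of \<open>g t\<close>; the case split avoids the exponent \<open>j - 1\<close> at
    \<open>j = 0\<close>.\<close>
  define p where "p j = (case j of 0 \<Rightarrow> 0 | Suc i \<Rightarrow>
      real j * g t ^ i * (l * (1 - 4 * (g t)\<^sup>2)) * c j * exp (b t * (real (n j) + 1/2)))" for j
  have q: "q l m j t = g t ^ j * c j * exp (b t * (real (n j) + 1/2))" for j t
    by (simp add: q_def g_def b_def n_def c_def)
  have g': "(g has_real_derivative l * (1 - 4 * (g t)\<^sup>2)) (at t)"
    unfolding g_def by (auto intro!: derivative_eq_intros simp: field_simps power2_eq_square)
  have b': "(b has_real_derivative - 4 * l * g t) (at t)"
    unfolding b_def g_def by (auto intro!: derivative_eq_intros simp: tanh_def field_simps)
  \<comment> \<open>The shift by \<open>2\<close> is the step from \<open>n (Suc j)\<close> to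
    \<open>n j\<close>.\<close>
  have exp_b: "exp (b t * (u + 2)) = exp (b t * u) * (1 - 4 * (g t)\<^sup>2)" for u
  proof -
    have "exp (2 * b t) = (exp (b t))\<^sup>2"
      by (simp add: exp_double)
    also have "\<dots> = 1 - 4 * (g t)\<^sup>2"
      by (simp add: b_def g_def exp_minus tanh_def power_divide field_simps)
        (simp add: cosh_square_eq)
    finally show ?thesis
      by (simp add: distrib_left exp_add mult.commute)
  qed
  have q': "((\<lambda>t. q l m j t) has_real_derivative p j - 4 * l * g t * (n j + 1/2) * q l m j t) (at t)" for j
  proof (cases j)
    case 0
    show ?thesis
      unfolding q 0 by (auto intro!: derivative_eq_intros b' simp: p_def)
  next
    case (Suc i)
    have "((\<lambda>t. exp (b t * (n j + 1/2))) has_real_derivative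
        exp (b t * (n j + 1/2)) * (- 4 * l * g t * (n j + 1/2))) (at t)"
      by (auto intro!: derivative_eq_intros b')
    from DERIV_mult[OF DERIV_cmult_right[OF DERIV_power_Suc[OF g', of i]] this] show ?thesis
      unfolding q Suc by (rule DERIV_cong) (simp add: p_def algebra_simps)
  qed
  have G': "((\<lambda>t. G k (g t)) has_vector_derivative (l * (1 - 4 * (g t)\<^sup>2)) *\<^sub>R (- G (k + 2) (g t))) (at t)" for k
    using vector_diff_chain_at[OF g'[unfolded has_real_derivative_iff_has_vector_derivative] G_deriv]
      tanh_bound[of "2 * l * t"] by (simp add: g_def comp_def)
  have W: "W l m = (\<lambda>t. \<Sum>j<Suc m. q l m j t *\<^sub>R G (n j) (g t))"
    by (simp only: W_def[abs_def] n_def g_def)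
  have W': "(W l m has_vector_derivative
      (\<Sum>j<Suc m. q l m j t *\<^sub>R ((l * (1 - 4 * (g t)\<^sup>2)) *\<^sub>R (- G (n j + 2) (g t))) +
        (p j - 4 * l * g t * (n j + 1/2) * q l m j t) *\<^sub>R G (n j) (g t))) (at t)"
    unfolding W by (intro has_vector_derivative_sum has_vector_derivative_scaleR q' G')
  \<comment> \<open>The two new factors of the falling factorial in \<open>c (Suc j)\<close> supply
    the lowering coefficient, and \<open>1 - 4 * (g t)\<^sup>2\<close> is absorbed by the
    exponential.\<close>
  have p_Suc: "p (Suc j) *\<^sub>R G (n (Suc j)) (g t) =
      (q l m j t * l * (real (n j) * real (n j - 1))) *\<^sub>R G (n j - 2) (g t)" for j
  proof -
    have c_Suc: "real (Suc j) * c (Suc j) = c j * ((real m - real (2 * j)) * (real m - real (Suc (2 * j))))"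
      unfolding c_def fact_Suc by (simp del: of_nat_Suc)
    have "p (Suc j) = q l m j t * l * (real (n j) * real (n j - 1))"
    proof (cases "2 * j + 2 \<le> m")
      case True
      then have n: "real m - real (2 * j) = real (n j)" "real m - real (Suc (2 * j)) = real (n j - 1)"
          "real (n j) + 1/2 = real (n (Suc j)) + 1/2 + 2"
        by (auto simp: n_def)
      have "p (Suc j) = g t ^ j * (l * (1 - 4 * (g t)\<^sup>2)) * (real (Suc j) * c (Suc j)) *
          exp (b t * (real (n (Suc j)) + 1/2))"
        by (simp add: p_def)
      also have "\<dots> = q l m j t * l * (real (n j) * real (n j - 1))"
        unfolding c_Suc q n exp_b by (simp only: mult_ac)
      finally show ?thesis .
    next
      \<comment> \<open>Both sides vanish: on the left the falling factorial is zero, and on the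
        right either \<open>c j\<close> is zero or \<open>n j\<close> is \<open>0\<close> or
        \<open>1\<close>.\<close>
      case False
      then have "(\<Prod>i<2 * Suc j. real m - real i) = 0"
        by (intro prod_zero) auto
      moreover have "c j * (real (n j) * real (n j - 1)) = 0"
      proof (cases "m < 2 * j")
        case True
        then have "(\<Prod>i<2 * j. real m - real i) = 0"
          by (intro prod_zero) auto
        then show ?thesis by (simp add: c_def)
      next
        case m: False
        with False have "m = 2 * j \<or> m = 2 * j + 1" by linarith
        then show ?thesis by (auto simp: n_def)
      qed
      moreover have "q l m j t * l * (real (n j) * real (n j - 1)) =
          g t ^ j * exp (b t * (real (n j) + 1/2)) * l * (c j * (real (n j) * real (n j - 1)))"
        unfolding q by (simp only: mult_ac)
      ultimately show ?thesis
        by (simp only: p_def c_def[of "Suc j"] nat.case div_0 mult_zero_left mult_zero_right)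
    qed
    moreover have "n (Suc j) = n j - 2" by (simp add: n_def)
    ultimately show ?thesis by simp
  qed
  have "(\<Sum>j<Suc m. p j *\<^sub>R G (n j) (g t)) = (\<Sum>j<m. p (Suc j) *\<^sub>R G (n (Suc j)) (g t))"
    by (simp only: sum.lessThan_Suc_shift) (simp add: p_def)
  also have "\<dots> = (\<Sum>j<Suc m. (q l m j t * l * (real (n j) * real (n j - 1))) *\<^sub>R G (n j - 2) (g t))"
  proof -
    \<comment> \<open>This removes the extra term \<open>j = m\<close> of the longer sum.\<close>
    have "real (n m) = 0" by (simp add: n_def)
    then show ?thesis unfolding p_Suc by simp
  qed
  finally have sum_p: "(\<Sum>j<Suc m. p j *\<^sub>R G (n j) (g t)) = \<dots>" .
  have eq: "(\<Sum>j<Suc m. q l m j t *\<^sub>R ((l * (1 - 4 * (g t)\<^sup>2)) *\<^sub>R (- G (n j + 2) (g t))) +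
        (p j - 4 * l * g t * (n j + 1/2) * q l m j t) *\<^sub>R G (n j) (g t)) =
      (\<Sum>j<Suc m. q l m j t *\<^sub>R l *\<^sub>R ((real (n j) * real (n j - 1)) *\<^sub>R G (n j - 2) (g t)
        - (4 * g t * (n j + 1/2)) *\<^sub>R G (n j) (g t) - (1 - 4 * (g t)\<^sup>2) *\<^sub>R G (n j + 2) (g t)))"
    (is "?L = ?R")
  proof -
    have "?L = (\<Sum>j<Suc m. p j *\<^sub>R G (n j) (g t)) +
        (\<Sum>j<Suc m. (- 4 * l * g t * (n j + 1/2) * q l m j t) *\<^sub>R G (n j) (g t)
          - (q l m j t * l * (1 - 4 * (g t)\<^sup>2)) *\<^sub>R G (n j + 2) (g t))"
      by (subst sum.distrib[symmetric], rule sum.cong) (simp_all add: algebra_simps)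
    also have "\<dots> = ?R"
      unfolding sum_p by (subst sum.distrib[symmetric], rule sum.cong) (simp_all add: algebra_simps)
    finally show ?thesis .
  qed
  have mem: "(W l m t, \<Sum>j<Suc m. q l m j t *\<^sub>R l *\<^sub>R ((real (n j) * real (n j - 1)) *\<^sub>R G (n j - 2) (g t)
        - (4 * g t * (n j + 1/2)) *\<^sub>R G (n j) (g t) - (1 - 4 * (g t)\<^sup>2) *\<^sub>R G (n j + 2) (g t))) \<in> C l"
  proof -
    \<comment> \<open>Summing pairs in the product space lets the subspace property of
      \<open>C l\<close> treat both components at once.\<close>
    have "(\<Sum>j<Suc m. q l m j t *\<^sub>R (G (n j) (g t), l *\<^sub>R ((real (n j) * real (n j - 1)) *\<^sub>R G (n j - 2) (g t)
        - (4 * g t * (n j + 1/2)) *\<^sub>R G (n j) (g t) - (1 - 4 * (g t)\<^sup>2) *\<^sub>R G (n j + 2) (g t)))) \<in> C l"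
      using tanh_bound[of "2 * l * t"]
      by (intro subspace_sum[OF C_subspace] subspace_scale[OF C_subspace] G_in_domain) (simp add: g_def)
    then show ?thesis
      by (simp only: W scaleR_Pair sum_prod fst_conv snd_conv)
  qed
  show ?thesis
    by (rule exI, rule conjI[OF W'[unfolded eq] mem])
qed

lemma W_zero: "W l m 0 = f m"
proof -
  have "W l m 0 = (\<Sum>j<Suc m. if j = 0 then f m else 0)"
    unfolding W_def by (intro sum.cong) (auto simp: q_def G_zero power_0_left)
  then show ?thesis by simp
qed

text \<open>Since \<open>C l\<close> is a subspace, it contains the difference of the two curves
  paired with its derivative, and \<open>C_skew\<close> makes this a skew evolution starting at
  zero.\<close>

lemma group_eq_W:
  assumes V: "unitary_group V" and gen: "generator V = C l"
  shows "V t (f m) = W l m t"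
proof -
  obtain y where y: "\<And>t. (W l m has_vector_derivative y t) (at t)" "\<And>t. (W l m t, y t) \<in> C l"
    using W_evolution by metis
  define A where "A = l *\<^sub>R (a (a (f m)) - a' (a' (f m)))"
  have "(f m, A) \<in> generator V"
    unfolding gen C_def A_def operator_graph_def
    by (rule closure_subset[THEN subsetD], rule image_eqI[OF refl f_in_span])
  note orbit = unitary_group_orbit[OF V this]
  have "W l m t - V t (f m) = 0"
  proof (rule skew_evolution_zero[where z' = "\<lambda>t. y t - V t A"])
    show "((\<lambda>t. W l m t - V t (f m)) has_vector_derivative y t - V t A) (at t)" for t
      by (intro has_vector_derivative_diff y orbit)
    show "Re (cinner (W l m t - V t (f m)) (y t - V t A)) = 0" for t
      using subspace_diff[OF C_subspace y(2)[of t] orbit(2)[of t, unfolded gen]] by (simp add: C_skew)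
    show "W l m 0 - V 0 (f m) = 0"
      using V by (simp add: W_zero unitary_group_def)
  qed
  then show ?thesis by simp
qed

end

section \<open>The product formula for the unitary exponential\<close>

theorem theorem4p1:
  fixes e :: "nat \<Rightarrow> 'h :: complex_hilbert"
    and U a a' :: "'h \<Rightarrow> 'h"
    and l \<beta> \<gamma> :: real
  assumes basis: "orthonormal_basis e"
    and a: "a = annihilation e"
    and a': "a' = creation e"
    and U: "is_unitary_exp
              (closure (operator_graph (cvec.span (range e))
                 (\<lambda>x. l *\<^sub>R (a (a x) - a' (a' x))))) U"
    and \<gamma>: "2 * \<gamma> = tanh (2 * l)"
    and \<beta>: "exp \<beta> = 1 / cosh (2 * l)"
  shows "\<forall>x \<in> cvec.span (range e).
     summable (exp_term (\<lambda>y. \<gamma> *\<^sub>R a (a y)) x) \<and>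
     summable (exp_term (\<lambda>y. (- \<gamma>) *\<^sub>R a' (a' y))
       (exp_number e \<beta> (exp_series (\<lambda>y. \<gamma> *\<^sub>R a (a y)) x))) \<and>
     U x = exp_series (\<lambda>y. (- \<gamma>) *\<^sub>R a' (a' y))
       (exp_number e \<beta> (exp_series (\<lambda>y. \<gamma> *\<^sub>R a (a y)) x))"
proof -
  interpret oscillator e by unfold_locales (rule basis)
  \<comment> \<open>The factor \<open>1\<close> is the time at which \<open>q\<close> and
    \<open>W\<close> are evaluated below.\<close>
  have \<gamma>_eq: "\<gamma> = tanh (2 * l * 1) / 2" using \<gamma> by simp
  then have \<gamma>_bound: "\<bar>\<gamma>\<bar> < 1/2" using tanh_bound by (simp only:)
  have "exp \<beta> = exp (- ln (cosh (2 * l)))"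
    using \<beta> by (simp add: exp_minus divide_inverse)
  then have \<beta>_eq: "\<beta> = - ln (cosh (2 * l * 1))" by simp
  let ?F = "\<lambda>y. \<gamma> *\<^sub>R a (a y)" and ?E = "\<lambda>y. (- \<gamma>) *\<^sub>R a' (a' y)"
  have F: "linear_on_span e ?F" "\<And>x. x \<in> D \<Longrightarrow> ?F x \<in> D"
    and E: "linear_on_span e ?E" "\<And>x. x \<in> D \<Longrightarrow> ?E x \<in> D"
    unfolding a a' by (simp_all add: linear_on_span_scaleR_fun annihilation2_linear creation2_linear
        span_scaleR annihilation_in_span creation_in_span del: scaleR_minus_left)
  obtain V where V: "unitary_group V" "generator V = C l" "U = V 1"
    using U unfolding is_unitary_exp_def C_def a a' by blast
  have F_f: "summable (exp_term ?F (f n))"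
    "exp_series ?F (f n) =
      (\<Sum>j<Suc n. (\<gamma> ^ j / fact j * (\<Prod>i<2*j. real n - real i)) *\<^sub>R f (n - 2 * j))" for n
    using exp_series_annihilation_f[OF \<gamma>_bound, of n] by (simp_all only: a)
  have F_summable: "summable (exp_term ?F (e n))" for n
  proof -
    have "exp_term ?F (e n) = (\<lambda>k. (1 / sqrt (fact n)) *\<^sub>R exp_term ?F (f n) k)"
      unfolding basis_eq_f[of n]
      by (rule ext) (rule linear_on_span_scaleR[OF exp_term_linear_on_span[OF F] f_in_span])
    then show ?thesis by (simp only: summable_scaleR_right[OF F_f(1)])
  qed
  note F_series = exp_series_linear_on_span[OF F F_summable]
  \<comment> \<open>The annihilation series is finite on each \<open>f n\<close>, so its values stay
    in \<open>D\<close>, where the other two factors are linear.\<close>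
  have F_span: "exp_series ?F x \<in> D" if "x \<in> D" for x
  proof (rule linear_on_span_in_span[OF F_series(2) _ that])
    show "exp_series ?F (e n) \<in> D" for n
    proof -
      have "exp_series ?F (e n) = (1 / sqrt (fact n)) *\<^sub>R exp_series ?F (f n)"
        unfolding basis_eq_f[of n] by (rule linear_on_span_scaleR[OF F_series(2) f_in_span])
      then show ?thesis
        unfolding F_f(2) by (simp only:) (intro span_scaleR cvec.span_sum f_in_span)
    qed
  qed
  have E_f: "summable (exp_term ?E (f n))" for n
  proof -
    have "exp_term ?E (f n) = (\<lambda>k. ((- \<gamma>) ^ k / fact k) *\<^sub>R f (n + 2 * k))"
      unfolding a' by (rule ext) (rule exp_term_creation)
    then show ?thesis
      by (simp only: G_summable[OF \<gamma>_bound])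
  qed
  have E_summable: "summable (exp_term ?E (e n))" for n
  proof -
    have "exp_term ?E (e n) = (\<lambda>k. (1 / sqrt (fact n)) *\<^sub>R exp_term ?E (f n) k)"
      unfolding basis_eq_f[of n]
      by (rule ext) (rule linear_on_span_scaleR[OF exp_term_linear_on_span[OF E] f_in_span])
    then show ?thesis by (simp only: summable_scaleR_right[OF E_f])
  qed
  note E_series = exp_series_linear_on_span[OF E E_summable]
  let ?R = "\<lambda>x. exp_series ?E (exp_number e \<beta> (exp_series ?F x))"
  \<comment> \<open>Once both sides are known to be linear on \<open>D\<close>, they need comparing
    only on the multiples \<open>f m\<close> of the basis vectors.\<close>
  have R_linear: "linear_on_span e ?R"
    by (rule linear_on_span_compose[OF E_series(2) linear_on_span_compose[OF exp_number_linear F_series(2) F_span]])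
      (simp_all add: exp_number_in_span F_span)
  have U_linear: "linear_on_span e U"
    using V by (simp add: unitary_group_def unitary_linear_on_span)
  have R_f: "?R (f m) = W l m 1" for m
  proof -
    \<comment> \<open>The coefficient of the annihilation series times the eigenvalue of
      \<open>exp_number\<close> at \<open>f (m - 2 * j)\<close> is \<open>q l m j 1\<close>.\<close>
    have "exp_number e \<beta> (exp_series ?F (f m)) = (\<Sum>j<Suc m. q l m j 1 *\<^sub>R f (m - 2 * j))"
      unfolding F_f(2) linear_on_span_sum[OF exp_number_linear f_in_span] exp_number_f scaleR_scaleR
      by (simp only: q_def \<gamma>_eq \<beta>_eq)
    then have "?R (f m) = (\<Sum>j<Suc m. q l m j 1 *\<^sub>R exp_series ?E (f (m - 2 * j)))"
      by (simp only: linear_on_span_sum[OF E_series(2) f_in_span])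
    then show ?thesis
      by (simp only: W_def G_def a' \<gamma>_eq)
  qed
  have "U (e n) = ?R (e n)" for n
    unfolding basis_eq_f[of n] linear_on_span_scaleR[OF U_linear f_in_span]
      linear_on_span_scaleR[OF R_linear f_in_span]
    by (simp only: R_f V(3) group_eq_W[OF V(1,2)])
  then have U_eq: "U x = ?R x" if "x \<in> D" for x
    by (rule linear_on_span_eq[OF U_linear R_linear _ that])
  show ?thesis
  proof (intro ballI conjI)
    fix x assume x: "x \<in> D"
    show "summable (exp_term ?F x)"
      by (rule F_series(1)[OF _ x])
    show "summable (exp_term ?E (exp_number e \<beta> (exp_series ?F x)))"
      by (rule E_series(1)[OF _ exp_number_in_span[OF F_span[OF x]]])
    show "U x = ?R x"
      by (rule U_eq[OF x])
  qed
qed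

end
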